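(* Let $n\ge 1$ be an integer and let $\begin{bmatrix}A & B\\ B^* & C\end{bmatrix}\in\mathbb{M}_2(\mathbb{M}_n)$ be positive semidefinite. Then for $j=1,2,\ldots,n$, \[ 2s_j\bigl(\Phi(B)\bigr)\le s_j\bigl(\Phi(A)+\Phi(C)\bigr), \] and \[ 2s_j\bigl(\Psi(B)\bigr)\le s_j\bigl(\Phi(A)+\Phi(C)\bigr). \]
   Context: $\mathbb{M}_n$ is the space of $n\times n$ complex matrices, and $\mathbb{M}_2(\mathbb{M}_n)$ is the set of $2\times 2$ block matrices with blocks in $\mathbb{M}_n$, regarded also as $2n\times 2n$ complex matrices. For $X\in\mathbb{M}_n$, $\Phi(X)=(\mathrm{tr}\,X)I+X$ and $\Psi(X)=(\mathrm{tr}\,X)I-X$, where $I$ is the $n\times n$ identity matrix and $\mathrm{tr}$ is the usual trace. $s_j(X)$ is the $j$-th largest singular value of $X$ (counted with multiplicity). *)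

theory Defs
  imports
    "Jordan_Normal_Form.Schur_Decomposition"
    "Jordan_Normal_Form.Char_Poly"
begin

definition mtrace :: "complex mat \<Rightarrow> complex" where
  "mtrace A = (\<Sum>i<dim_row A. A $$ (i, i))"

definition Phi :: "complex mat \<Rightarrow> complex mat" where
  "Phi X = mtrace X \<cdot>\<^sub>m 1\<^sub>m (dim_row X) + X"

definition Psi :: "complex mat \<Rightarrow> complex mat" where
  "Psi X = mtrace X \<cdot>\<^sub>m 1\<^sub>m (dim_row X) - X"

definition psd :: "complex mat \<Rightarrow> bool" where
  "psd A \<longleftrightarrow> square_mat A \<and> mat_adjoint A = A \<and>
     (\<forall>x \<in> carrier_vec (dim_row A). 0 \<le> Re ((A *\<^sub>v x) \<bullet>c x))"

text \<open>
  The eigenvalues of \<open>X\<^sup>* X\<close>, counted with algebraic multiplicity, are real and nonnegative,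
  so taking \<^const>\<open>Re\<close> loses nothing.
\<close>

definition singular_values :: "complex mat \<Rightarrow> real list" where
  "singular_values X =
     rev (sorted_list_of_multiset
       (image_mset (\<lambda>z. sqrt (Re z)) (proots (char_poly (mat_adjoint X * X)))))"

text \<open>The index \<open>j\<close> starts at 1; the value is meaningful only for \<open>1 \<le> j \<le> dim_col X\<close>.\<close>

definition sv :: "nat \<Rightarrow> complex mat \<Rightarrow> real" where
  "sv j X = singular_values X ! (j - 1)"

end

theory Submission
  imports Defs "HOL-Analysis.L2_Norm"
begin

text \<open>
  Write \<open>H\<close> for the positive semidefinite block matrix, \<open>T = tr A + tr C\<close>, \<open>tr B = t w\<close> with
  \<open>t \<ge> 0\<close> and \<open>\<bar>w\<bar> = 1\<close>, \<open>N = \<Phi>(A) + \<Phi>(C) = T I + A + C\<close>, and let \<open>Y\<close> be \<open>\<Phi>(B)\<close> or \<open>\<Psi>(B)\<close>. Both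
  choices satisfy \<open>\<parallel>Y x\<parallel> \<le> t \<parallel>x\<parallel> + \<parallel>B x\<parallel>\<close>, and this bound is all that the argument asks of \<open>Y\<close>.

  Put \<open>d = s\<^sub>j(Y) - t\<close>. If \<open>d \<le> 0\<close> the claim follows from \<open>2 t \<le> T \<le> s\<^sub>j(N)\<close>. If \<open>d > 0\<close>, then
  \<open>\<parallel>B v\<parallel> \<ge> d \<parallel>v\<parallel>\<close> for all \<open>v\<close> in the span of the first \<open>j\<close> right singular vectors of \<open>Y\<close>. For such
  \<open>v\<close> take \<open>u = B v / d\<close> in the role of the left singular vector. Positivity of \<open>H\<close> at
  \<open>(u, -v)\<close> says \<open>4 Re \<langle>B v, u\<rangle> \<le> \<langle>H (u, v), (u, v)\<rangle>\<close>, so it remains to bound the form of \<open>H\<close> from above.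

  The form of \<open>H\<close> is the square of a seminorm \<open>q\<close>. Rotate the coordinates: with
  \<open>p = (u + w v) / 2\<close> and \<open>r = (u - w v) / 2\<close>,
  \<open>(u, v) = (p, w\<^sup>* p) + (r, - w\<^sup>* r)\<close>, where \<open>w\<^sup>*\<close> is the conjugate of \<open>w\<close>. The two summands are controlled differently:
  \<^item> \<open>q(p, w\<^sup>* p)\<^sup>2 \<le> 2 \<langle>(A + C) p, p\<rangle>\<close>, because \<open>q(p, w\<^sup>* p)\<^sup>2 + q(p, - w\<^sup>* p)\<^sup>2 = 2 \<langle>(A + C) p, p\<rangle>\<close>;
  \<^item> \<open>q(r, - w\<^sup>* r)\<^sup>2 \<le> (T - 2 t) \<parallel>r\<parallel>\<^sup>2\<close>, because the operator norm is at most the Hilbert-Schmidt norm,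
    whose square is the trace \<open>T - 2 Re (w\<^sup>* tr B)\<close>.

  The map \<open>v \<mapsto> p\<close> is linear, so by counting dimensions some nonzero \<open>v\<close> in the \<open>j\<close>-dimensional span
  has \<open>p\<close> orthogonal to the first \<open>j - 1\<close> singular vectors of \<open>N\<close>; there
  \<open>\<langle>(A + C) p, p\<rangle> \<le> (s\<^sub>j(N) - T) \<parallel>p\<parallel>\<^sup>2\<close>. Cauchy-Schwarz and the parallelogram law
  \<open>2 \<parallel>p\<parallel>\<^sup>2 + 2 \<parallel>r\<parallel>\<^sup>2 = \<parallel>u\<parallel>\<^sup>2 + \<parallel>v\<parallel>\<^sup>2 \<le> 2 \<parallel>B v\<parallel>\<^sup>2 / d\<^sup>2\<close> combine the bounds to
  \<open>4 d \<le> 2 (s\<^sub>j(N) - T) + (T - 2 t)\<close>, that is \<open>4 s\<^sub>j(Y) \<le> 2 s\<^sub>j(N) - T + 2 t \<le> 2 s\<^sub>j(N)\<close>.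

  The upper bound on \<open>q\<close> is \<open>block_offdiagonal_bound\<close>, the two families of singular vectors come from
  \<open>singular_value_subspaces\<close> (which rests on the spectral theorem
  \<open>hermitian_unitary_diagonalization\<close>), the dimension count is \<open>exists_vector_with_prescribed_zeros\<close>,
  and \<open>two_sv_le\<close> puts them together.
\<close>

section \<open>Adjoints and unitary diagonalization\<close>

lemma dim_mat_adjoint [simp]:
  "dim_row (mat_adjoint A) = dim_col A" "dim_col (mat_adjoint A) = dim_row A"
  by (auto simp: mat_adjoint_def mat_of_rows_def)

lemma mat_adjoint_carrier [simp]:
  "A \<in> carrier_mat nr nc \<Longrightarrow> mat_adjoint A \<in> carrier_mat nc nr"
  by auto

lemma index_mat_adjoint [simp]:
  "i < dim_col A \<Longrightarrow> j < dim_row A \<Longrightarrow> mat_adjoint A $$ (i, j) = conjugate (A $$ (j, i))"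
  by (simp add: mat_adjoint_def mat_of_rows_def)

lemma mat_adjoint_adjoint [simp]: "mat_adjoint (mat_adjoint (A :: complex mat)) = A"
  by (rule eq_matI) auto

lemma index_adjoint_mult:
  fixes A B :: "complex mat"
  assumes "A \<in> carrier_mat n nr" "B \<in> carrier_mat n nc" "i < nr" "j < nc"
  shows "(mat_adjoint A * B) $$ (i, j) = col B j \<bullet>c col A i"
  using assms by (auto simp: scalar_prod_def mult.commute intro!: sum.cong)

lemma mat_adjoint_mult:
  fixes A B :: "complex mat"
  assumes "A \<in> carrier_mat nr n" "B \<in> carrier_mat n nc"
  shows "mat_adjoint (A * B) = mat_adjoint B * mat_adjoint A"
  using assms by (intro eq_matI) (auto simp: scalar_prod_def mult.commute intro!: sum.cong)

lemma cscalar_prod_adjoint: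
  fixes A :: "complex mat"
  assumes "A \<in> carrier_mat nr nc" "x \<in> carrier_vec nc" "y \<in> carrier_vec nr"
  shows "(A *\<^sub>v x) \<bullet>c y = x \<bullet>c (mat_adjoint A *\<^sub>v y)"
proof -
  have "(A *\<^sub>v x) \<bullet>c y = (\<Sum>i<nr. \<Sum>j<nc. A $$ (i,j) * x $ j * cnj (y $ i))"
    using assms by (auto simp: scalar_prod_def atLeast0LessThan sum_distrib_right intro!: sum.cong)
  also have "\<dots> = (\<Sum>j<nc. \<Sum>i<nr. A $$ (i,j) * x $ j * cnj (y $ i))"
    by (rule sum.swap)
  also have "\<dots> = x \<bullet>c (mat_adjoint A *\<^sub>v y)"
    using assms
    by (auto simp: scalar_prod_def atLeast0LessThan sum_distrib_left mult_ac intro!: sum.cong)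
  finally show ?thesis .
qed

lemma cscalar_prod_swap:
  fixes x y :: "complex vec"
  assumes "x \<in> carrier_vec n" "y \<in> carrier_vec n"
  shows "y \<bullet>c x = cnj (x \<bullet>c y)"
  using assms by (auto simp: scalar_prod_def mult.commute intro!: sum.cong)

lemma mult_unit_vec_col:
  fixes A :: "complex mat"
  assumes "A \<in> carrier_mat nr nc" "j < nc"
  shows "A *\<^sub>v unit_vec nc j = col A j"
  using assms by (intro eq_vecI) auto

text \<open>
  Gram-Schmidt applied to a basis that starts with \<open>v\<close> keeps \<open>v\<close> in front and yields orthogonal columns;
  scaling each column to length 1 makes the matrix unitary and changes the first column by a scalar.
\<close>

lemma exists_unitary_with_first_column:
  fixes v :: "complex vec"
  assumes v: "v \<in> carrier_vec n" and v0: "v \<noteq> 0\<^sub>v n"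
  shows "\<exists>W k. W \<in> carrier_mat n n \<and> mat_adjoint W * W = 1\<^sub>m n \<and> col W 0 = k \<cdot>\<^sub>v v"
proof -
  interpret cof_vec_space n "TYPE(complex)" .
  define b where "b = basis_completion v"
  define ws where "ws = gram_schmidt n b"
  note b = basis_completion[OF v v0, folded b_def]
  have n: "n \<noteq> 0" using v v0 by auto
  then obtain vs where bv: "b = v # vs" using b(6,7) by (cases b) auto
  note gs = gram_schmidt_result[OF b(2,4,5) ws_def]
  have len: "length ws = n" using gs(4) b(6) by simp
  have hd: "hd ws = v" unfolding ws_def bv using v by simp
  define c :: "nat \<Rightarrow> complex" where "c i = of_real (1 / sqrt (Re (ws ! i \<bullet>c ws ! i)))" for i
  define us where "us = map (\<lambda>i. c i \<cdot>\<^sub>v ws ! i) [0..<n]"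
  define W where "W = mat_of_cols n us"
  have wsc: "ws ! i \<in> carrier_vec n" if "i < n" for i using gs(3) len that by auto
  have W: "W \<in> carrier_mat n n" unfolding W_def us_def by auto
  have colW: "col W i = c i \<cdot>\<^sub>v ws ! i" if "i < n" for i
    unfolding W_def using that wsc by (subst col_mat_of_cols) (auto simp: us_def)
  have cc: "c i * cnj (c i) * (ws ! i \<bullet>c ws ! i) = 1" if i: "i < n" for i
  proof -
    have "ws ! i \<bullet>c ws ! i \<ge> 0" by (rule conjugate_square_ge_0_vec)
    moreover have "ws ! i \<bullet>c ws ! i \<noteq> 0"
      using corthogonalD[OF gs(2), of i i] i len by simp
    ultimately obtain r where r: "r > 0" "ws ! i \<bullet>c ws ! i = of_real r"
      by (metis complex_is_Real_iff less_eq_complex_def of_real_Re of_real_eq_0_iff order_le_less zero_complex.sel)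
    have "c i * cnj (c i) = of_real (1 / r)"
      using r by (simp add: c_def flip: of_real_mult)
    thus ?thesis using r by (simp flip: of_real_mult)
  qed
  have "mat_adjoint W * W = 1\<^sub>m n"
  proof (rule eq_matI)
    fix i j assume ij: "i < dim_row (1\<^sub>m n :: complex mat)" "j < dim_col (1\<^sub>m n :: complex mat)"
    hence ij: "i < n" "j < n" by auto
    have "(mat_adjoint W * W) $$ (i, j) = col W j \<bullet>c col W i"
      by (rule index_adjoint_mult[OF W W ij])
    also have "\<dots> = c j * cnj (c i) * (ws ! j \<bullet>c ws ! i)"
      using wsc[OF ij(1)] wsc[OF ij(2)] ij by (simp add: colW conjugate_smult_vec)
    also have "\<dots> = (1\<^sub>m n :: complex mat) $$ (i, j)"
    proof (cases "i = j")
      case True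
      thus ?thesis using cc[OF ij(1)] ij by simp
    next
      case False
      hence "ws ! j \<bullet>c ws ! i = 0"
        using corthogonalD[OF gs(2), of j i] ij len by auto
      thus ?thesis using False ij by simp
    qed
    finally show "(mat_adjoint W * W) $$ (i, j) = (1\<^sub>m n :: complex mat) $$ (i, j)" .
  qed (use W in auto)
  moreover have "col W 0 = c 0 \<cdot>\<^sub>v v"
    using colW[of 0] n hd len by (cases ws) auto
  ultimately show ?thesis using W by blast
qed

text \<open>
  The eigenvalues may be listed in any order \<open>es\<close>: this freedom is what later allows the diagonal to be
  sorted like the singular values. Deflation: a unitary matrix whose first column is an eigenvector for the head of
  \<open>es\<close> turns \<open>M\<close> into a matrix whose first column, hence by symmetry also the first row, vanishes off the
  diagonal, and the characteristic polynomial of the remaining block is the product over the tail.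
\<close>

theorem hermitian_unitary_diagonalization:
  fixes M :: "complex mat"
  assumes "M \<in> carrier_mat n n" "mat_adjoint M = M"
    and "char_poly M = (\<Prod>e\<leftarrow>es. [:- e, 1:])"
  shows "\<exists>P \<in> carrier_mat n n. mat_adjoint P * P = 1\<^sub>m n \<and>
           mat_adjoint P * M * P = mat_diag n (\<lambda>i. es ! i)"
  using assms
proof (induction es arbitrary: n M)
  case Nil
  hence "n = 0" using degree_monic_char_poly[of M n] by auto
  thus ?case using Nil by (intro bexI[of _ "1\<^sub>m 0"] conjI eq_matI) (auto simp: mat_diag_def)
next
  case (Cons e es n M)
  note M = Cons.prems(1) and herm = Cons.prems(2)
  have "monic (\<Prod>e\<leftarrow>es. [:- e, 1:])" by (rule monic_prod_list) auto
  hence "degree (char_poly M) = Suc (degree (\<Prod>e\<leftarrow>es. [:- e, 1:]))"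
    unfolding Cons.prems(3) list.map prod_list.Cons by (subst degree_mult_eq) auto
  then obtain m where n: "n = Suc m" using degree_monic_char_poly[OF M] by (cases n) auto
  have "eigenvalue M e"
    unfolding eigenvalue_root_char_poly[OF M] Cons.prems(3) by simp
  then obtain v where v: "v \<in> carrier_vec n" "v \<noteq> 0\<^sub>v n" "M *\<^sub>v v = e \<cdot>\<^sub>v v"
    using M unfolding eigenvalue_def eigenvector_def by auto
  from exists_unitary_with_first_column[OF v(1,2)] obtain W k
    where W: "W \<in> carrier_mat n n" and WW: "mat_adjoint W * W = 1\<^sub>m n"
      and W0: "col W 0 = k \<cdot>\<^sub>v v" by auto
  have W': "mat_adjoint W \<in> carrier_mat n n" using W by simp
  define N where "N = mat_adjoint W * M * W"
  have N: "N \<in> carrier_mat n n" using W M by (auto simp: N_def)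
  have hermN: "mat_adjoint N = N"
    unfolding N_def using M W W' herm
    by (simp add: mat_adjoint_mult[of _ n n _ n] assoc_mult_mat[of _ n n _ n _ n])
  have "N *\<^sub>v unit_vec n 0 = mat_adjoint W *\<^sub>v (M *\<^sub>v (W *\<^sub>v unit_vec n 0))"
    using M W W' by (simp add: N_def assoc_mult_mat_vec[of _ n n _ n] mult_carrier_mat[of _ n n])
  also have "W *\<^sub>v unit_vec n 0 = k \<cdot>\<^sub>v v"
    using W W0 n by (metis mult_unit_vec_col zero_less_Suc)
  also have "M *\<^sub>v (k \<cdot>\<^sub>v v) = e \<cdot>\<^sub>v (k \<cdot>\<^sub>v v)"
    using M v by (simp add: mult_mat_vec[of _ n n] smult_smult_assoc mult.commute)
  also have "k \<cdot>\<^sub>v v = W *\<^sub>v unit_vec n 0"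
    using W W0 n by (metis mult_unit_vec_col zero_less_Suc)
  also have "mat_adjoint W *\<^sub>v (e \<cdot>\<^sub>v (W *\<^sub>v unit_vec n 0)) = e \<cdot>\<^sub>v unit_vec n 0"
  proof -
    have "mat_adjoint W *\<^sub>v (e \<cdot>\<^sub>v (W *\<^sub>v unit_vec n 0))
        = e \<cdot>\<^sub>v (mat_adjoint W *\<^sub>v (W *\<^sub>v unit_vec n 0))"
      using W W' by (intro mult_mat_vec) auto
    also have "mat_adjoint W *\<^sub>v (W *\<^sub>v unit_vec n 0) = (mat_adjoint W * W) *\<^sub>v unit_vec n 0"
      using W W' by (simp add: assoc_mult_mat_vec[of _ n n _ n])
    finally show ?thesis by (simp add: WW)
  qed
  finally have Ne: "N *\<^sub>v unit_vec n 0 = e \<cdot>\<^sub>v unit_vec n 0" .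
  have N0: "N $$ (i, 0) = (if i = 0 then e else 0)" if "i < n" for i
  proof -
    have "N $$ (i, 0) = (N *\<^sub>v unit_vec n 0) $ i"
      using N that n by simp
    thus ?thesis unfolding Ne using that n by simp
  qed
  have N0': "N $$ (0, i) = 0" if "i < n" "i \<noteq> 0" for i
  proof -
    have "N $$ (0, i) = cnj (N $$ (i, 0))"
      using index_mat_adjoint[of 0 N i] hermN N that by auto
    thus ?thesis using N0 that by simp
  qed
  \<comment> \<open>the block that is left after splitting off the eigenvector\<close>
  define M' where "M' = mat m m (\<lambda>(i, j). N $$ (Suc i, Suc j))"
  let ?e = "mat 1 1 (\<lambda>_. e)"
  have M': "M' \<in> carrier_mat m m" by (simp add: M'_def)
  have Nb: "N = four_block_mat ?e (0\<^sub>m 1 m) (0\<^sub>m m 1) M'"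
    by (rule eq_matI) (use N n in \<open>auto simp: M'_def N0 N0'\<close>)
  have hermM': "mat_adjoint M' = M'"
  proof (rule eq_matI)
    fix i j assume "i < dim_row M'" "j < dim_col M'"
    thus "mat_adjoint M' $$ (i, j) = M' $$ (i, j)"
      using index_mat_adjoint[of "Suc i" N "Suc j"] hermN N n by (auto simp: M'_def)
  qed (auto simp: M'_def)
  have WW2: "W * mat_adjoint W = 1\<^sub>m n"
    by (rule mat_mult_left_right_inverse[OF W' W WW])
  have "similar_mat_wit N M (mat_adjoint W) W"
    by (rule similar_mat_witI[OF WW WW2 N_def N M W' W])
  hence "char_poly N = char_poly M"
    by (intro char_poly_similar) (auto simp: similar_mat_def)
  also have "char_poly N = char_poly ?e * char_poly M'"
    unfolding Nb by (rule char_poly_four_block_zeros_col) (use M' in auto)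
  also have "char_poly ?e = [:- e, 1:]"
    by (simp add: char_poly_defs det_def sign_def)
  finally have "[:- e, 1:] * char_poly M' = [:- e, 1:] * (\<Prod>e\<leftarrow>es. [:- e, 1:])"
    by (simp add: Cons.prems(3))
  hence "char_poly M' = (\<Prod>e\<leftarrow>es. [:- e, 1:])"
    by (metis mult_cancel_left pCons_eq_0_iff zero_neq_one)
  from Cons.IH[OF M' hermM' this] obtain P
    where P: "P \<in> carrier_mat m m" and PP: "mat_adjoint P * P = 1\<^sub>m m"
      and PMP: "mat_adjoint P * M' * P = mat_diag m (\<lambda>i. es ! i)" by auto
  have P': "mat_adjoint P \<in> carrier_mat m m" using P by simp
  \<comment> \<open>extends a unitary matrix of size \<open>m\<close> by a fixed first coordinate\<close>
  define b where "b = (\<lambda>Q :: complex mat. four_block_mat (1\<^sub>m 1) (0\<^sub>m 1 m) (0\<^sub>m m 1) Q)"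
  have b: "b Q \<in> carrier_mat n n" if "Q \<in> carrier_mat m m" for Q
    using four_block_carrier_mat[of "1\<^sub>m 1" 1 1 Q m m] that n by (auto simp: b_def)
  note bP = b[OF P] and bP' = b[OF P']
  have adj: "mat_adjoint (b P) = b (mat_adjoint P)"
    unfolding b_def by (rule eq_matI) (use P in auto)
  have diag_mult: "four_block_mat X (0\<^sub>m 1 m) (0\<^sub>m m 1) Y * four_block_mat X' (0\<^sub>m 1 m) (0\<^sub>m m 1) Y'
      = four_block_mat (X * X') (0\<^sub>m 1 m) (0\<^sub>m m 1) (Y * Y')"
    if "X \<in> carrier_mat 1 1" "X' \<in> carrier_mat 1 1" "Y \<in> carrier_mat m m" "Y' \<in> carrier_mat m m"
    for X X' Y Y' :: "complex mat"
    using that by (subst mult_four_block_mat[of _ 1 1 _ m _ m _ _ 1 _ m]) auto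
  have prod: "b (mat_adjoint P) * four_block_mat X (0\<^sub>m 1 m) (0\<^sub>m m 1) Y * b P
      = four_block_mat X (0\<^sub>m 1 m) (0\<^sub>m m 1) (mat_adjoint P * Y * P)"
    if X: "X \<in> carrier_mat 1 1" and Y: "Y \<in> carrier_mat m m" for X Y
    using X Y P P' unfolding b_def
    by (simp add: diag_mult mult_carrier_mat[of _ m m] del: One_nat_def)
  have "mat_adjoint (W * b P) * (W * b P) = b (mat_adjoint P) * (mat_adjoint W * W) * b P"
    using W W' bP bP'
    by (simp add: mat_adjoint_mult[of _ n n _ n] adj assoc_mult_mat[of _ n n _ n _ n] mult_carrier_mat[of _ n n])
  also have "\<dots> = b (mat_adjoint P) * b (1\<^sub>m m) * b P" by (simp add: WW n b_def)
  also have "\<dots> = 1\<^sub>m n"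
    unfolding fun_cong[OF b_def, of "1\<^sub>m m"] using P' PP by (subst prod) (auto simp: n)
  finally have 1: "mat_adjoint (W * b P) * (W * b P) = 1\<^sub>m n" .
  have "mat_adjoint (W * b P) * M * (W * b P) = b (mat_adjoint P) * N * b P"
    using W W' M bP bP'
    by (simp add: mat_adjoint_mult[of _ n n _ n] adj N_def assoc_mult_mat[of _ n n _ n _ n] mult_carrier_mat[of _ n n])
  also have "\<dots> = four_block_mat ?e (0\<^sub>m 1 m) (0\<^sub>m m 1) (mat_diag m (\<lambda>i. es ! i))"
    unfolding Nb using M' by (subst prod) (auto simp: PMP)
  also have "\<dots> = mat_diag n (\<lambda>i. (e # es) ! i)"
    by (rule eq_matI) (auto simp: n mat_diag_def nth_Cons')
  finally show ?case using 1 W bP by (intro bexI[of _ "W * b P"]) auto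
qed

section \<open>Singular values and singular subspaces\<close>

definition vnorm :: "complex vec \<Rightarrow> real" where
  "vnorm x = sqrt (Re (x \<bullet>c x))"

lemma cscalar_prod_self: "x \<bullet>c x = of_real (\<Sum>i<dim_vec x. (cmod (x $ i))\<^sup>2)"
  by (auto simp: scalar_prod_def atLeast0LessThan complex_norm_square[symmetric] intro!: sum.cong)

lemma vnorm_sq: "(vnorm x)\<^sup>2 = (\<Sum>i<dim_vec x. (cmod (x $ i))\<^sup>2)"
  by (simp add: vnorm_def cscalar_prod_self sum_nonneg)

lemma vnorm_sq_eq_cscalar_prod: "(vnorm x)\<^sup>2 = Re (x \<bullet>c x)"
  unfolding vnorm_sq by (simp add: cscalar_prod_self)

lemma vnorm_nonneg [simp]: "0 \<le> vnorm x"
  by (simp add: vnorm_def cscalar_prod_self sum_nonneg)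

lemma vnorm_pos:
  assumes "x \<in> carrier_vec n" "x \<noteq> 0\<^sub>v n"
  shows "0 < vnorm x"
proof -
  have "x \<bullet>c x > 0" using assms by simp
  thus ?thesis by (simp add: vnorm_def less_complex_def)
qed

lemma vnorm_unitary:
  assumes "P \<in> carrier_mat n n" "mat_adjoint P * P = 1\<^sub>m n" "c \<in> carrier_vec n"
  shows "vnorm (P *\<^sub>v c) = vnorm c"
proof -
  have "(P *\<^sub>v c) \<bullet>c (P *\<^sub>v c) = c \<bullet>c ((mat_adjoint P * P) *\<^sub>v c)"
    using assms(1,3)
    by (subst cscalar_prod_adjoint[of _ n n]) (auto simp: assoc_mult_mat_vec[of _ n n _ n])
  thus ?thesis using assms(3) by (simp add: vnorm_def assms(2))
qed

lemma sorted_rev_singular_values: "sorted (rev (singular_values X))"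
  by (simp add: singular_values_def)

text \<open>
  The columns of \<open>P\<close> are orthonormal right singular vectors in the order of the list of singular
  values. In this basis \<open>X\<^sup>* X\<close> is diagonal with entries \<open>\<parallel>X (P e\<^sub>i)\<parallel>\<^sup>2\<close>; hence these
  eigenvalues are real and nonnegative and their square roots are genuine.
\<close>

theorem singular_basis_exists:
  assumes X: "X \<in> carrier_mat n n"
  obtains P where "P \<in> carrier_mat n n" "mat_adjoint P * P = 1\<^sub>m n"
    "length (singular_values X) = n" "\<And>i. i < n \<Longrightarrow> 0 \<le> singular_values X ! i"
    "\<And>c. c \<in> carrier_vec n \<Longrightarrow>
       (vnorm (X *\<^sub>v (P *\<^sub>v c)))\<^sup>2 = (\<Sum>i<n. (singular_values X ! i)\<^sup>2 * (cmod (c $ i))\<^sup>2)"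
proof -
  define M where "M = mat_adjoint X * X"
  have M: "M \<in> carrier_mat n n" using X by (auto simp: M_def)
  have herm: "mat_adjoint M = M"
    unfolding M_def using X by (subst mat_adjoint_mult[of _ n n _ n]) auto
  obtain xs where xs: "char_poly M = (\<Prod>e\<leftarrow>xs. [:- e, 1:])" "length xs = n"
    using char_poly_factorized[OF M] by auto
  define f :: "complex \<Rightarrow> real" where "f = (\<lambda>z. sqrt (Re z))"
  \<comment> \<open>the eigenvalues of \<open>M\<close> in the order in which their square roots appear as singular values\<close>
  define es where "es = rev (sort_key f xs)"
  have len: "length es = n" by (simp add: es_def xs)
  have "proots (char_poly M) = mset xs"
    unfolding xs(1)
  proof (induction xs)
    case (Cons e xs)
    have "(\<Prod>e\<leftarrow>xs. [:- e, 1:]) \<noteq> 0" by (auto simp: prod_list_zero_iff)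
    thus ?case using Cons by (simp add: proots_mult del: mult_pCons_left)
  qed simp
  hence "singular_values X = rev (sort (map f xs))"
    unfolding singular_values_def M_def[symmetric] f_def[symmetric]
    by (simp flip: mset_map)
  also have "sort (map f xs) = map f (sort_key f xs)"
    by (rule properties_for_sort) auto
  finally have sv: "singular_values X = map f es" by (simp add: es_def rev_map)
  have "prod_list (map g es) = prod_list (map g xs)" for g :: "complex \<Rightarrow> complex poly"
    by (metis es_def mset_map mset_rev mset_sort prod_mset_prod_list)
  hence "char_poly M = (\<Prod>e\<leftarrow>es. [:- e, 1:])" by (simp add: xs)
  from hermitian_unitary_diagonalization[OF M herm this] obtain P
    where P: "P \<in> carrier_mat n n" "mat_adjoint P * P = 1\<^sub>m n"
      and PMP: "mat_adjoint P * M * P = mat_diag n (\<lambda>i. es ! i)" by auto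
  have key: "(vnorm (X *\<^sub>v (P *\<^sub>v c)))\<^sup>2 = Re (\<Sum>i<n. es ! i * (cmod (c $ i))\<^sup>2)"
    if c: "c \<in> carrier_vec n" for c
  proof -
    have P': "mat_adjoint P \<in> carrier_mat n n" "mat_adjoint X \<in> carrier_mat n n" using P X by auto
    let ?w = "P *\<^sub>v c"
    have w: "?w \<in> carrier_vec n" using P c by auto
    have "(X *\<^sub>v ?w) \<bullet>c (X *\<^sub>v ?w) = (M *\<^sub>v ?w) \<bullet>c ?w"
      using X P' w cscalar_prod_adjoint[of "mat_adjoint X" n n "X *\<^sub>v ?w" ?w]
      by (simp add: M_def assoc_mult_mat_vec[of _ n n _ n])
    also have "\<dots> = ((mat_adjoint P * M * P) *\<^sub>v c) \<bullet>c c"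
      using P P' M c w cscalar_prod_adjoint[of "mat_adjoint P" n n "M *\<^sub>v ?w" c]
      by (simp add: assoc_mult_mat_vec[of _ n n _ n] mult_carrier_mat[of _ n n])
    also have "\<dots> = (\<Sum>i<n. es ! i * (cmod (c $ i))\<^sup>2)"
    proof -
      have "(mat_diag n ((!) es) *\<^sub>v c) $ i = es ! i * c $ i" if "i < n" for i
      proof -
        have "(mat_diag n ((!) es) *\<^sub>v c) $ i = (\<Sum>k<n. (if i = k then es ! k else 0) * c $ k)"
          using that c by (auto simp: mat_diag_def scalar_prod_def atLeast0LessThan intro!: sum.cong)
        also have "\<dots> = (\<Sum>k<n. if i = k then es ! k * c $ k else 0)"
          by (rule sum.cong) auto
        finally show ?thesis using that by simp
      qed
      thus ?thesis unfolding PMP using c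
        by (auto simp: scalar_prod_def atLeast0LessThan complex_norm_square mult.assoc simp del: of_real_power index_mult_mat_vec intro!: sum.cong)
    qed
    finally have eq: "(X *\<^sub>v ?w) \<bullet>c (X *\<^sub>v ?w) = (\<Sum>i<n. es ! i * (cmod (c $ i))\<^sup>2)" .
    show "(vnorm (X *\<^sub>v ?w))\<^sup>2 = Re (\<Sum>i<n. es ! i * (cmod (c $ i))\<^sup>2)"
      unfolding vnorm_sq_eq_cscalar_prod eq ..
  qed
  have pos: "0 \<le> Re (es ! i)" if i: "i < n" for i
  proof -
    have "(\<Sum>k<n. es ! k * (cmod ((unit_vec n i :: complex vec) $ k))\<^sup>2) = (\<Sum>k<n. if k = i then es ! k else 0)"
      using i by (intro sum.cong) auto
    also have "\<dots> = es ! i" using i by simp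
    finally show ?thesis using key[of "unit_vec n i"] by (metis unit_vec_carrier zero_le_power2)
  qed
  show ?thesis
  proof (rule that[OF P])
    show "length (singular_values X) = n" by (simp add: sv len)
    show "0 \<le> singular_values X ! i" if "i < n" for i
      using pos[OF that] that by (simp add: sv len f_def)
    show "(vnorm (X *\<^sub>v (P *\<^sub>v c)))\<^sup>2 = (\<Sum>i<n. (singular_values X ! i)\<^sup>2 * (cmod (c $ i))\<^sup>2)"
      if c: "c \<in> carrier_vec n" for c
    proof -
      have "Re (\<Sum>i<n. es ! i * (cmod (c $ i))\<^sup>2) = (\<Sum>i<n. (singular_values X ! i)\<^sup>2 * (cmod (c $ i))\<^sup>2)"
        unfolding Re_sum
        by (intro sum.cong) (auto simp: sv len f_def pos Re_complex_of_real simp flip: of_real_power)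
      thus ?thesis using key[OF c] by simp
    qed
  qed
qed

text \<open>
  The two halves of the min-max principle that are used: \<open>X\<close> expands by at most \<open>s\<^sub>j\<close> on the vectors
  orthogonal to the first \<open>j - 1\<close> columns of \<open>P\<close>, and by at least \<open>s\<^sub>j\<close> on the span of the first \<open>j\<close>
  columns. Both subspaces are described by vanishing coordinates with respect to \<open>P\<close>.
\<close>

lemma singular_value_subspaces:
  assumes "X \<in> carrier_mat n n" "1 \<le> j" "j \<le> n"
  obtains P where "P \<in> carrier_mat n n" "mat_adjoint P * P = 1\<^sub>m n"
    "0 \<le> sv j X"
    "\<And>c. c \<in> carrier_vec n \<Longrightarrow> (\<And>i. i < j - 1 \<Longrightarrow> c $ i = 0) \<Longrightarrow>
        vnorm (X *\<^sub>v (P *\<^sub>v c)) \<le> sv j X * vnorm (P *\<^sub>v c)"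
    "\<And>c. c \<in> carrier_vec n \<Longrightarrow> (\<And>i. j \<le> i \<Longrightarrow> i < n \<Longrightarrow> c $ i = 0) \<Longrightarrow>
        sv j X * vnorm (P *\<^sub>v c) \<le> vnorm (X *\<^sub>v (P *\<^sub>v c))"
proof -
  from singular_basis_exists[OF assms(1)] obtain P
    where P: "P \<in> carrier_mat n n" "mat_adjoint P * P = 1\<^sub>m n"
      and len: "length (singular_values X) = n"
      and pos: "\<And>i. i < n \<Longrightarrow> 0 \<le> singular_values X ! i"
      and eq: "\<And>c. c \<in> carrier_vec n \<Longrightarrow>
       (vnorm (X *\<^sub>v (P *\<^sub>v c)))\<^sup>2 = (\<Sum>i<n. (singular_values X ! i)\<^sup>2 * (cmod (c $ i))\<^sup>2)"
    by blast
  have anti: "singular_values X ! k \<le> singular_values X ! i" if "i \<le> k" "k < n" for i k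
    using sorted_rev_nth_mono[OF sorted_rev_singular_values that(1)] that len by simp
  have sv: "sv j X = singular_values X ! (j - 1)" "j - 1 < n" using assms by (auto simp: sv_def)
  have rhs: "(sv j X * vnorm (P *\<^sub>v c))\<^sup>2 = (\<Sum>i<n. (sv j X)\<^sup>2 * (cmod (c $ i))\<^sup>2)"
    if "c \<in> carrier_vec n" for c
    using that vnorm_unitary[OF P that] by (simp add: power_mult_distrib vnorm_sq sum_distrib_left)
  have s0: "0 \<le> sv j X" using sv pos by simp
  show ?thesis
  proof (rule that[OF P s0])
    fix c :: "complex vec" assume c: "c \<in> carrier_vec n" and z: "\<And>i. i < j - 1 \<Longrightarrow> c $ i = 0"
    have "(singular_values X ! i)\<^sup>2 * (cmod (c $ i))\<^sup>2 \<le> (sv j X)\<^sup>2 * (cmod (c $ i))\<^sup>2" if "i < n" for i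
    proof (cases "i < j - 1")
      case False
      thus ?thesis using anti[of "j - 1" i] pos[OF that] that sv
        by (intro mult_right_mono power_mono) auto
    qed (simp add: z)
    hence "(vnorm (X *\<^sub>v (P *\<^sub>v c)))\<^sup>2 \<le> (sv j X * vnorm (P *\<^sub>v c))\<^sup>2"
      unfolding rhs[OF c] eq[OF c] by (intro sum_mono) auto
    thus "vnorm (X *\<^sub>v (P *\<^sub>v c)) \<le> sv j X * vnorm (P *\<^sub>v c)"
      by (rule power2_le_imp_le) (simp add: s0)
  next
    fix c :: "complex vec" assume c: "c \<in> carrier_vec n" and z: "\<And>i. j \<le> i \<Longrightarrow> i < n \<Longrightarrow> c $ i = 0"
    have "(sv j X)\<^sup>2 * (cmod (c $ i))\<^sup>2 \<le> (singular_values X ! i)\<^sup>2 * (cmod (c $ i))\<^sup>2" if "i < n" for i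
    proof (cases "j \<le> i")
      case False
      thus ?thesis using anti[of i "j - 1"] s0 that sv
        by (intro mult_right_mono power_mono) auto
    qed (simp add: z that)
    hence "(sv j X * vnorm (P *\<^sub>v c))\<^sup>2 \<le> (vnorm (X *\<^sub>v (P *\<^sub>v c)))\<^sup>2"
      unfolding rhs[OF c] eq[OF c] by (intro sum_mono) auto
    thus "sv j X * vnorm (P *\<^sub>v c) \<le> vnorm (X *\<^sub>v (P *\<^sub>v c))"
      by (rule power2_le_imp_le) simp
  qed
qed

text \<open>
  A dimension count: \<open>n - j\<close> coordinates of \<open>c\<close> and \<open>j - 1\<close> coordinates of \<open>K c\<close> are prescribed, which
  are \<open>n - 1\<close> homogeneous linear equations in \<open>n\<close> unknowns.
\<close>

lemma exists_vector_with_prescribed_zeros: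
  fixes K :: "complex mat"
  assumes K: "K \<in> carrier_mat n n" and j: "1 \<le> j" "j \<le> n"
  obtains c where "c \<in> carrier_vec n" "c \<noteq> 0\<^sub>v n"
    "\<And>i. i < j - 1 \<Longrightarrow> (K *\<^sub>v c) $ i = 0"
    "\<And>i. j \<le> i \<Longrightarrow> i < n \<Longrightarrow> c $ i = 0"
proof -
  \<comment> \<open>the equations as a square matrix; row \<open>j - 1\<close> is left zero, so \<open>L\<close> is singular\<close>
  define L where "L = mat\<^sub>r n n (\<lambda>i. if i < j - 1 then row K i else if i < j then 0\<^sub>v n else unit_vec n i)"
  have L: "L \<in> carrier_mat n n" by (simp add: L_def)
  have rowL: "row L i = (if i < j - 1 then row K i else if i < j then 0\<^sub>v n else unit_vec n i)"
    if "i < n" for i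
    unfolding L_def using that K by (subst row_mat_of_row_fun) auto
  have "transpose_mat L *\<^sub>v unit_vec n (j - 1) = row L (j - 1)"
    using j L mult_unit_vec_col[of "transpose_mat L" n n "j - 1"] by auto
  also have "\<dots> = 0\<^sub>v n" using rowL[of "j - 1"] j by auto
  finally have "det (transpose_mat L) = 0"
    using L j by (subst det_0_iff_vec_prod_zero[of _ n]) (auto intro!: exI[of _ "unit_vec n (j - 1)"])
  hence "det L = 0" using det_transpose[OF L] by simp
  then obtain c where c: "c \<in> carrier_vec n" "c \<noteq> 0\<^sub>v n" "L *\<^sub>v c = 0\<^sub>v n"
    using det_0_iff_vec_prod_zero[OF L] by auto
  have Lc: "row L i \<bullet> c = 0" if "i < n" for i
    using arg_cong[OF c(3), of "\<lambda>v. v $ i"] that L by simp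
  show ?thesis
  proof (rule that[OF c(1,2)])
    show "(K *\<^sub>v c) $ i = 0" if "i < j - 1" for i
      using Lc[of i] rowL[of i] that j K by simp
    show "c $ i = 0" if "j \<le> i" "i < n" for i
    proof -
      have "row L i = unit_vec n i" using rowL[of i] that by auto
      thus ?thesis using Lc[of i] that c by simp
    qed
  qed
qed

section \<open>The seminorm of a positive semidefinite matrix\<close>

definition psd_seminorm :: "complex mat \<Rightarrow> complex vec \<Rightarrow> real" where
  "psd_seminorm M x = sqrt (Re ((M *\<^sub>v x) \<bullet>c x))"

lemma psd_form_nonneg:
  "psd M \<Longrightarrow> M \<in> carrier_mat n n \<Longrightarrow> x \<in> carrier_vec n \<Longrightarrow> 0 \<le> Re ((M *\<^sub>v x) \<bullet>c x)"
  by (auto simp: psd_def)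

lemma psd_seminorm_nonneg:
  "psd M \<Longrightarrow> M \<in> carrier_mat n n \<Longrightarrow> x \<in> carrier_vec n \<Longrightarrow> 0 \<le> psd_seminorm M x"
  by (simp add: psd_seminorm_def psd_form_nonneg)

lemma psd_seminorm_sq:
  "psd M \<Longrightarrow> M \<in> carrier_mat n n \<Longrightarrow> x \<in> carrier_vec n \<Longrightarrow>
     (psd_seminorm M x)\<^sup>2 = Re ((M *\<^sub>v x) \<bullet>c x)"
  by (simp add: psd_seminorm_def psd_form_nonneg)

lemma form_smult:
  fixes M :: "complex mat"
  assumes "M \<in> carrier_mat n n" "x \<in> carrier_vec n"
  shows "(M *\<^sub>v (k \<cdot>\<^sub>v x)) \<bullet>c (k \<cdot>\<^sub>v x) = of_real ((cmod k)\<^sup>2) * ((M *\<^sub>v x) \<bullet>c x)"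
proof -
  have "(M *\<^sub>v (k \<cdot>\<^sub>v x)) \<bullet>c (k \<cdot>\<^sub>v x) = k * (cnj k * ((M *\<^sub>v x) \<bullet>c x))"
    using assms by (simp add: mult_mat_vec[of _ n n] conjugate_smult_vec)
  also have "\<dots> = (k * cnj k) * ((M *\<^sub>v x) \<bullet>c x)" by (rule mult.assoc[symmetric])
  also have "k * cnj k = of_real ((cmod k)\<^sup>2)" by (rule complex_norm_square[symmetric])
  finally show ?thesis .
qed

lemma psd_seminorm_smult:
  assumes "M \<in> carrier_mat n n" "x \<in> carrier_vec n"
  shows "psd_seminorm M (k \<cdot>\<^sub>v x) = cmod k * psd_seminorm M x"
  unfolding psd_seminorm_def form_smult[OF assms] by (simp add: real_sqrt_mult)

lemma psd_form_add:
  assumes psd: "psd M" and M: "M \<in> carrier_mat n n"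
    and x: "x \<in> carrier_vec n" and y: "y \<in> carrier_vec n"
  shows "Re ((M *\<^sub>v (x + y)) \<bullet>c (x + y))
    = Re ((M *\<^sub>v x) \<bullet>c x) + 2 * Re ((M *\<^sub>v x) \<bullet>c y) + Re ((M *\<^sub>v y) \<bullet>c y)"
proof -
  have "mat_adjoint M = M" using psd by (simp add: psd_def)
  hence "(M *\<^sub>v y) \<bullet>c x = cnj ((M *\<^sub>v x) \<bullet>c y)"
    using cscalar_prod_adjoint[OF M y x] cscalar_prod_swap[of "M *\<^sub>v x" n y] M x y by simp
  thus ?thesis
    using M x y
    by (simp add: mult_add_distrib_mat_vec[of _ n n] conjugate_add_vec[of _ n]
        add_scalar_prod_distrib[of _ n] scalar_prod_add_distrib[of _ n])
qed

text \<open>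
  The quadratic \<open>t \<mapsto> \<langle>M (x + t y), x + t y\<rangle>\<close> is nonnegative, so its discriminant is not positive.
  The form may be degenerate, hence the separate case of a vanishing leading coefficient.
\<close>

lemma psd_cauchy_schwarz:
  assumes psd: "psd M" and M: "M \<in> carrier_mat n n"
    and x: "x \<in> carrier_vec n" and y: "y \<in> carrier_vec n"
  shows "Re ((M *\<^sub>v x) \<bullet>c y) \<le> psd_seminorm M x * psd_seminorm M y"
proof -
  define a b c where "a = psd_seminorm M x" and "b = Re ((M *\<^sub>v x) \<bullet>c y)" and "c = psd_seminorm M y"
  have a: "0 \<le> a" "0 \<le> c" using psd_seminorm_nonneg[OF psd M] x y by (auto simp: a_def c_def)
  have quad: "0 \<le> a\<^sup>2 + 2 * t * b + t\<^sup>2 * c\<^sup>2" for t :: real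
  proof -
    have ty: "of_real t \<cdot>\<^sub>v y \<in> carrier_vec n" using y by simp
    have "0 \<le> Re ((M *\<^sub>v (x + of_real t \<cdot>\<^sub>v y)) \<bullet>c (x + of_real t \<cdot>\<^sub>v y))"
      using psd_form_nonneg[OF psd M] x ty by simp
    also have "\<dots> = Re ((M *\<^sub>v x) \<bullet>c x) + 2 * Re ((M *\<^sub>v x) \<bullet>c (of_real t \<cdot>\<^sub>v y))
        + Re ((M *\<^sub>v (of_real t \<cdot>\<^sub>v y)) \<bullet>c (of_real t \<cdot>\<^sub>v y))"
      by (rule psd_form_add[OF psd M x ty])
    also have "(M *\<^sub>v x) \<bullet>c (of_real t \<cdot>\<^sub>v y) = of_real t * ((M *\<^sub>v x) \<bullet>c y)"
      using M x y by (simp add: conjugate_smult_vec)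
    finally show ?thesis
      using psd_seminorm_sq[OF psd M] x y
      by (simp add: form_smult[OF M y] a_def b_def c_def flip: of_real_power)
  qed
  have "b \<le> a * c"
  proof (cases "c = 0")
    case True
    show ?thesis
    proof (rule ccontr)
      assume "\<not> b \<le> a * c"
      hence "b > 0" using True by simp
      thus False using quad[of "- (a\<^sup>2 + 1) / (2 * b)"] True by (simp add: field_simps)
    qed
  next
    case False
    hence "0 \<le> a\<^sup>2 - b\<^sup>2 / c\<^sup>2"
      using quad[of "- b / c\<^sup>2"] by (simp add: power2_eq_square)
    hence "b\<^sup>2 \<le> (a * c)\<^sup>2" using False by (simp add: field_simps power_mult_distrib)
    thus ?thesis by (rule power2_le_imp_le) (use a in simp)
  qed
  thus ?thesis by (simp add: a_def b_def c_def)
qed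

lemma psd_seminorm_triangle:
  assumes psd: "psd M" and M: "M \<in> carrier_mat n n"
    and x: "x \<in> carrier_vec n" and y: "y \<in> carrier_vec n"
  shows "psd_seminorm M (x + y) \<le> psd_seminorm M x + psd_seminorm M y"
proof (rule power2_le_imp_le)
  have "(psd_seminorm M (x + y))\<^sup>2 = Re ((M *\<^sub>v (x + y)) \<bullet>c (x + y))"
    using psd_seminorm_sq[OF psd M] x y by simp
  also have "\<dots> \<le> (psd_seminorm M x)\<^sup>2 + 2 * (psd_seminorm M x * psd_seminorm M y) + (psd_seminorm M y)\<^sup>2"
    unfolding psd_form_add[OF assms] using psd_seminorm_sq[OF psd M] x y psd_cauchy_schwarz[OF assms]
    by simp
  finally show "(psd_seminorm M (x + y))\<^sup>2 \<le> (psd_seminorm M x + psd_seminorm M y)\<^sup>2"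
    by (simp add: power2_sum)
  show "0 \<le> psd_seminorm M x + psd_seminorm M y"
    using psd_seminorm_nonneg[OF psd M] x y by simp
qed

lemma psd_one: "psd (1\<^sub>m n)"
proof -
  have "mat_adjoint (1\<^sub>m n :: complex mat) = 1\<^sub>m n" by (rule eq_matI) auto
  thus ?thesis by (auto simp: psd_def cscalar_prod_self sum_nonneg)
qed

lemma psd_seminorm_one: "x \<in> carrier_vec n \<Longrightarrow> psd_seminorm (1\<^sub>m n) x = vnorm x"
  by (simp add: psd_seminorm_def vnorm_def)

lemma vnorm_triangle:
  assumes "x \<in> carrier_vec n" "y \<in> carrier_vec n"
  shows "vnorm (x + y) \<le> vnorm x + vnorm y"
  using psd_seminorm_triangle[OF psd_one[of n] _ assms] assms by (simp add: psd_seminorm_one[of _ n])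

lemma Re_cscalar_prod_le:
  assumes "x \<in> carrier_vec n" "y \<in> carrier_vec n"
  shows "Re (x \<bullet>c y) \<le> vnorm x * vnorm y"
  using psd_cauchy_schwarz[OF psd_one[of n] _ assms] assms by (simp add: psd_seminorm_one[of _ n])

lemma vnorm_smult: "vnorm (k \<cdot>\<^sub>v x) = cmod k * vnorm x"
proof -
  have x: "x \<in> carrier_vec (dim_vec x)" by (rule carrier_vecI) (rule refl)
  have "vnorm (k \<cdot>\<^sub>v x) = psd_seminorm (1\<^sub>m (dim_vec x)) (k \<cdot>\<^sub>v x)"
    by (rule psd_seminorm_one[symmetric]) (use x in simp)
  also have "\<dots> = cmod k * vnorm x"
    by (simp only: psd_seminorm_smult[OF one_carrier_mat x] psd_seminorm_one[OF x])
  finally show ?thesis .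
qed

text \<open>
  The operator norm of a seminorm is at most its Hilbert-Schmidt norm: expand \<open>x\<close> in the standard basis,
  use subadditivity, and apply the Cauchy-Schwarz inequality to the coefficients.
\<close>

lemma seminorm_le_hilbert_schmidt:
  fixes q :: "complex vec \<Rightarrow> real"
  assumes nonneg: "\<And>x. x \<in> carrier_vec n \<Longrightarrow> 0 \<le> q x"
    and triangle: "\<And>x y. x \<in> carrier_vec n \<Longrightarrow> y \<in> carrier_vec n \<Longrightarrow> q (x + y) \<le> q x + q y"
    and smult: "\<And>k x. x \<in> carrier_vec n \<Longrightarrow> q (k \<cdot>\<^sub>v x) = cmod k * q x"
    and x: "x \<in> carrier_vec n"
  shows "q x \<le> sqrt (\<Sum>i<n. (q (unit_vec n i))\<^sup>2) * vnorm x"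
proof -
  \<comment> \<open>\<open>x\<close> truncated to its first \<open>k\<close> coordinates, for the induction over the terms of the expansion\<close>
  define tr where "tr k = vec n (\<lambda>i. if i < k then x $ i else 0)" for k
  have "q (tr k) \<le> (\<Sum>i<k. cmod (x $ i) * q (unit_vec n i))" if "k \<le> n" for k
    using that
  proof (induction k)
    case 0
    have "tr 0 = 0 \<cdot>\<^sub>v tr 0" by (rule eq_vecI) (auto simp: tr_def)
    moreover have "q (0 \<cdot>\<^sub>v tr 0) = 0" using smult[of "tr 0" 0] by (simp add: tr_def)
    ultimately have "q (tr 0) = 0" by metis
    thus ?case by simp
  next
    case (Suc k)
    have "tr (Suc k) = tr k + x $ k \<cdot>\<^sub>v unit_vec n k"
      using Suc.prems by (intro eq_vecI) (auto simp: tr_def less_Suc_eq)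
    hence "q (tr (Suc k)) \<le> q (tr k) + q (x $ k \<cdot>\<^sub>v unit_vec n k)"
      using triangle[of "tr k" "x $ k \<cdot>\<^sub>v unit_vec n k"] by (simp add: tr_def)
    thus ?case using Suc smult[of "unit_vec n k" "x $ k"] by simp
  qed
  from this[of n] have "q (tr n) \<le> (\<Sum>i<n. cmod (x $ i) * q (unit_vec n i))" by simp
  also have "tr n = x" using x by (auto simp: tr_def)
  also have "(\<Sum>i<n. cmod (x $ i) * q (unit_vec n i))
      = (\<Sum>i<n. \<bar>q (unit_vec n i)\<bar> * \<bar>cmod (x $ i)\<bar>)"
    by (intro sum.cong) (auto simp: nonneg)
  also have "\<dots> \<le> L2_set (\<lambda>i. q (unit_vec n i)) {..<n} * L2_set (\<lambda>i. cmod (x $ i)) {..<n}"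
    by (rule L2_set_mult_ineq)
  also have "L2_set (\<lambda>i. cmod (x $ i)) {..<n} = sqrt ((vnorm x)\<^sup>2)"
    using x unfolding vnorm_sq by (simp add: L2_set_def)
  finally show ?thesis by (simp add: L2_set_def)
qed

section \<open>Positive semidefinite block matrices\<close>

lemma conjugate_append_vec: "conjugate (x @\<^sub>v y) = conjugate x @\<^sub>v conjugate y"
  by (rule eq_vecI) auto

lemma smult_append_vec: "k \<cdot>\<^sub>v (x @\<^sub>v y) = (k \<cdot>\<^sub>v x) @\<^sub>v (k \<cdot>\<^sub>v y)"
  by (rule eq_vecI) auto

lemma block_form:
  fixes A B C :: "complex mat"
  assumes A: "A \<in> carrier_mat n n" and B: "B \<in> carrier_mat n n" and C: "C \<in> carrier_mat n n"
    and x: "x \<in> carrier_vec n" and y: "y \<in> carrier_vec n"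
  shows "Re ((four_block_mat A B (mat_adjoint B) C *\<^sub>v (x @\<^sub>v y)) \<bullet>c (x @\<^sub>v y))
    = Re ((A *\<^sub>v x) \<bullet>c x) + 2 * Re ((B *\<^sub>v y) \<bullet>c x) + Re ((C *\<^sub>v y) \<bullet>c y)"
proof -
  have B': "mat_adjoint B \<in> carrier_mat n n" using B by simp
  have "(mat_adjoint B *\<^sub>v x) \<bullet>c y = cnj ((B *\<^sub>v y) \<bullet>c x)"
    using cscalar_prod_adjoint[OF B' x y] cscalar_prod_swap[of "B *\<^sub>v y" n x] B x y by simp
  thus ?thesis
    unfolding four_block_mat_mult_vec[OF A B B' C x y] conjugate_append_vec
    using A B B' C x y mult_mat_vec_carrier[OF B' x]
    by (subst scalar_prod_append[of _ n _ n]) (auto simp: add_scalar_prod_distrib[of _ n])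
qed

lemma block_form_phase:
  fixes A B C :: "complex mat"
  assumes A: "A \<in> carrier_mat n n" and B: "B \<in> carrier_mat n n" and C: "C \<in> carrier_mat n n"
    and x: "x \<in> carrier_vec n" and z: "cmod z = 1"
  shows "Re ((four_block_mat A B (mat_adjoint B) C *\<^sub>v (x @\<^sub>v z \<cdot>\<^sub>v x)) \<bullet>c (x @\<^sub>v z \<cdot>\<^sub>v x))
    = Re ((A *\<^sub>v x) \<bullet>c x) + 2 * Re (z * ((B *\<^sub>v x) \<bullet>c x)) + Re ((C *\<^sub>v x) \<bullet>c x)"
proof -
  have "(B *\<^sub>v (z \<cdot>\<^sub>v x)) \<bullet>c x = z * ((B *\<^sub>v x) \<bullet>c x)"
    using B x by (simp add: mult_mat_vec[of _ n n])
  thus ?thesis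
    using block_form[OF A B C x, of "z \<cdot>\<^sub>v x"] x z by (simp add: form_smult[OF C x])
qed

lemma append_phase_add:
  assumes "x \<in> carrier_vec n" "y \<in> carrier_vec n"
  shows "(x + y) @\<^sub>v z \<cdot>\<^sub>v (x + y) = (x @\<^sub>v z \<cdot>\<^sub>v x) + (y @\<^sub>v z \<cdot>\<^sub>v (y :: complex vec))"
  using assms by (simp add: append_vec_add[of _ n _ _ n] smult_add_distrib_vec[of _ n])

text \<open>
  With \<open>u = p + r\<close> and \<open>v = w\<^sup>* (p - r)\<close>, the left-hand side is the difference of the forms of the block
  matrix at \<open>(u, v)\<close> and \<open>(u, -v)\<close>, so it is at most the form at \<open>(u, v) = (p, w\<^sup>* p) + (r, - w\<^sup>* r)\<close>.
  Write \<open>T\<close> for \<open>tr A + tr C\<close>. The triangle inequality separates the two rotated components. On the first one the form is at most that of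
  \<open>2 (A + C)\<close>; on the second one the seminorm is bounded by its Hilbert-Schmidt norm, whose
  square \<open>T - 2 t\<close> is small exactly because \<open>w\<^sup>*\<close> rotates the trace of \<open>B\<close> to the positive axis. As the square of a
  norm, \<open>T - 2 t\<close> is also nonnegative, which is the second claim.
\<close>

lemma block_offdiagonal_bound:
  fixes A B C :: "complex mat"
  assumes A: "A \<in> carrier_mat n n" and B: "B \<in> carrier_mat n n" and C: "C \<in> carrier_mat n n"
    and psd: "psd (four_block_mat A B (mat_adjoint B) C)"
    and p: "p \<in> carrier_vec n" and r: "r \<in> carrier_vec n"
    and w: "cmod w = 1" "mtrace B = of_real t * w"
  shows "4 * Re ((B *\<^sub>v (cnj w \<cdot>\<^sub>v (p - r))) \<bullet>c (p + r))
      \<le> (sqrt (2 * (Re ((A *\<^sub>v p) \<bullet>c p) + Re ((C *\<^sub>v p) \<bullet>c p)))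
          + sqrt (Re (mtrace A) + Re (mtrace C) - 2 * t) * vnorm r)\<^sup>2"
    and "2 * t \<le> Re (mtrace A) + Re (mtrace C)"
proof -
  define H where "H = four_block_mat A B (mat_adjoint B) C"
  define q where "q = psd_seminorm H"
  note psd = psd[folded H_def]
  have H: "H \<in> carrier_mat (n + n) (n + n)"
    using four_block_carrier_mat[OF A C] by (simp add: H_def)
  have ww: "w * cnj w = 1" using w(1) by (simp add: complex_norm_square[symmetric])
  have cw: "cmod (cnj w) = 1" "cmod (- cnj w) = 1" using w(1) by auto
  have ac: "x @\<^sub>v z \<cdot>\<^sub>v x \<in> carrier_vec (n + n)" if "x \<in> carrier_vec n" for x z
    using that by simp
  note form = block_form_phase[OF A B C, folded H_def]
  note q_sq = psd_seminorm_sq[OF psd H, folded q_def]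
  note q_nonneg = psd_seminorm_nonneg[OF psd H, folded q_def]
  define u v where "u = p + r" and "v = cnj w \<cdot>\<^sub>v (p - r)"
  have uv: "u \<in> carrier_vec n" "v \<in> carrier_vec n" using p r by (auto simp: u_def v_def)

  \<comment> \<open>the forms at \<open>(p, w\<^sup>* p)\<close> and \<open>(p, - w\<^sup>* p)\<close> are nonnegative and add up to the right-hand side\<close>
  have "(q (p @\<^sub>v cnj w \<cdot>\<^sub>v p))\<^sup>2 \<le> 2 * (Re ((A *\<^sub>v p) \<bullet>c p) + Re ((C *\<^sub>v p) \<bullet>c p))"
    using form[OF p cw(1)] form[OF p cw(2)] psd_form_nonneg[OF psd H ac[OF p], of "- cnj w"]
      q_sq[OF ac[OF p], of "cnj w"] by simp
  hence diag: "q (p @\<^sub>v cnj w \<cdot>\<^sub>v p) \<le> sqrt (2 * (Re ((A *\<^sub>v p) \<bullet>c p) + Re ((C *\<^sub>v p) \<bullet>c p)))"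
    by (rule real_le_rsqrt)

  have unit: "(X *\<^sub>v unit_vec n i) \<bullet>c unit_vec n i = X $$ (i, i)"
    if "X \<in> carrier_mat n n" "i < n" for X :: "complex mat" and i
  proof -
    have "conjugate (unit_vec n i) = (unit_vec n i :: complex vec)"
      by (rule eq_vecI) (auto simp: unit_vec_def)
    thus ?thesis using that by simp
  qed
  have "(\<Sum>i<n. (q (unit_vec n i @\<^sub>v (- cnj w) \<cdot>\<^sub>v unit_vec n i))\<^sup>2)
      = (\<Sum>i<n. Re (A $$ (i, i)) + Re (C $$ (i, i)) - 2 * Re (cnj w * B $$ (i, i)))"
    using q_sq[OF ac, of "unit_vec n _" "- cnj w"] form[OF _ cw(2), of "unit_vec n _"] unit[OF A] unit[OF B] unit[OF C]
    by (intro sum.cong) simp_all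
  also have "\<dots> = Re (mtrace A) + Re (mtrace C) - 2 * Re (cnj w * mtrace B)"
    using A B C by (simp add: mtrace_def sum.distrib sum_subtractf sum_distrib_left)
  also have "cnj w * mtrace B = of_real t * (w * cnj w)" by (simp add: w(2))
  finally have tr: "(\<Sum>i<n. (q (unit_vec n i @\<^sub>v (- cnj w) \<cdot>\<^sub>v unit_vec n i))\<^sup>2)
      = Re (mtrace A) + Re (mtrace C) - 2 * t"
    by (simp add: ww)
  thus "2 * t \<le> Re (mtrace A) + Re (mtrace C)"
    using sum_nonneg[of "{..<n}" "\<lambda>i. (q (unit_vec n i @\<^sub>v (- cnj w) \<cdot>\<^sub>v unit_vec n i))\<^sup>2"] by simp
  have offdiag: "q (r @\<^sub>v (- cnj w) \<cdot>\<^sub>v r) \<le> sqrt (Re (mtrace A) + Re (mtrace C) - 2 * t) * vnorm r"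
    unfolding tr[symmetric]
  proof (rule seminorm_le_hilbert_schmidt)
    fix x y :: "complex vec" and k assume x: "x \<in> carrier_vec n"
    show "0 \<le> q (x @\<^sub>v (- cnj w) \<cdot>\<^sub>v x)" by (rule q_nonneg[OF ac[OF x]])
    have "(k \<cdot>\<^sub>v x) @\<^sub>v (- cnj w) \<cdot>\<^sub>v (k \<cdot>\<^sub>v x) = k \<cdot>\<^sub>v (x @\<^sub>v (- cnj w) \<cdot>\<^sub>v x)"
      by (simp add: smult_append_vec smult_smult_assoc mult.commute)
    thus "q ((k \<cdot>\<^sub>v x) @\<^sub>v (- cnj w) \<cdot>\<^sub>v (k \<cdot>\<^sub>v x)) = cmod k * q (x @\<^sub>v (- cnj w) \<cdot>\<^sub>v x)"
      using psd_seminorm_smult[OF H ac[OF x]] by (simp add: q_def)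
    assume y: "y \<in> carrier_vec n"
    show "q ((x + y) @\<^sub>v (- cnj w) \<cdot>\<^sub>v (x + y))
        \<le> q (x @\<^sub>v (- cnj w) \<cdot>\<^sub>v x) + q (y @\<^sub>v (- cnj w) \<cdot>\<^sub>v y)"
      unfolding append_phase_add[OF x y] q_def
      by (rule psd_seminorm_triangle[OF psd H ac[OF x] ac[OF y]])
  qed (rule r)

  have "u @\<^sub>v v = (p @\<^sub>v cnj w \<cdot>\<^sub>v p) + (r @\<^sub>v (- cnj w) \<cdot>\<^sub>v r)"
    using p r by (intro eq_vecI) (auto simp: u_def v_def algebra_simps)
  hence "q (u @\<^sub>v v) \<le> q (p @\<^sub>v cnj w \<cdot>\<^sub>v p) + q (r @\<^sub>v (- cnj w) \<cdot>\<^sub>v r)"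
    using psd_seminorm_triangle[OF psd H ac[OF p] ac[OF r]] by (simp add: q_def)
  hence le: "q (u @\<^sub>v v) \<le> sqrt (2 * (Re ((A *\<^sub>v p) \<bullet>c p) + Re ((C *\<^sub>v p) \<bullet>c p)))
      + sqrt (Re (mtrace A) + Re (mtrace C) - 2 * t) * vnorm r" (is "_ \<le> ?rhs")
    using diag offdiag by linarith
  have uvc: "u @\<^sub>v v \<in> carrier_vec (n + n)" "u @\<^sub>v (- 1) \<cdot>\<^sub>v v \<in> carrier_vec (n + n)" using uv by auto
  have mv: "(- 1) \<cdot>\<^sub>v v \<in> carrier_vec n" using uv by simp
  \<comment> \<open>positivity at \<open>(u, -v)\<close>\<close>
  have "0 \<le> Re ((A *\<^sub>v u) \<bullet>c u) - 2 * Re ((B *\<^sub>v v) \<bullet>c u) + Re ((C *\<^sub>v v) \<bullet>c v)"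
    using psd_form_nonneg[OF psd H uvc(2)] uv B
    unfolding H_def block_form[OF A B C uv(1) mv] form_smult[OF C uv(2)]
    by (simp add: mult_mat_vec[of _ n n])
  hence "4 * Re ((B *\<^sub>v v) \<bullet>c u) \<le> (q (u @\<^sub>v v))\<^sup>2"
    unfolding q_sq[OF uvc(1)] unfolding H_def block_form[OF A B C uv] by linarith
  also have "\<dots> \<le> ?rhs\<^sup>2"
    using le q_nonneg[OF uvc(1)] by (rule power_mono)
  finally show "4 * Re ((B *\<^sub>v (cnj w \<cdot>\<^sub>v (p - r))) \<bullet>c (p + r)) \<le> ?rhs\<^sup>2"
    by (simp add: u_def v_def)
qed

lemma vnorm_parallelogram:
  assumes "p \<in> carrier_vec n" "r \<in> carrier_vec n" "cmod k = 1"
  shows "(vnorm (p + r))\<^sup>2 + (vnorm (k \<cdot>\<^sub>v (p - r)))\<^sup>2 = 2 * (vnorm p)\<^sup>2 + 2 * (vnorm r)\<^sup>2"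
proof -
  have "(cmod (a + b))\<^sup>2 + (cmod (a - b))\<^sup>2 = 2 * (cmod a)\<^sup>2 + 2 * (cmod b)\<^sup>2" for a b :: complex
    unfolding cmod_power2 by (simp add: power2_eq_square algebra_simps)
  hence "(\<Sum>i<n. (cmod (p $ i + r $ i))\<^sup>2 + (cmod (p $ i - r $ i))\<^sup>2)
      = (\<Sum>i<n. 2 * (cmod (p $ i))\<^sup>2 + 2 * (cmod (r $ i))\<^sup>2)" by simp
  thus ?thesis
    unfolding vnorm_smult assms(3) vnorm_sq mult_1
    using assms(1,2) by (simp add: sum.distrib sum_distrib_left)
qed

section \<open>Comparison of singular values\<close>

lemma smult_mat_mat_vec:
  fixes M :: "complex mat"
  assumes "M \<in> carrier_mat nr nc" "x \<in> carrier_vec nc"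
  shows "(k \<cdot>\<^sub>m M) *\<^sub>v x = k \<cdot>\<^sub>v (M *\<^sub>v x)"
  using assms by (intro eq_vecI) (auto simp: scalar_prod_def sum_distrib_left mult.assoc)

lemma cauchy_schwarz_two:
  fixes a b x y :: real
  shows "(a * x + b * y)\<^sup>2 \<le> (a\<^sup>2 + b\<^sup>2) * (x\<^sup>2 + y\<^sup>2)"
proof -
  have "0 \<le> (a * y - b * x)\<^sup>2" by simp
  thus ?thesis by (simp add: power2_eq_square algebra_simps)
qed

text \<open>
  The matrix \<open>Y\<close> enters only through the norm bound, which \<open>\<Phi>(B)\<close> and \<open>\<Psi>(B)\<close>
  share. The loss \<open>t\<close> in passing from \<open>Y\<close> to \<open>B\<close> is paid for by the
  summand \<open>T I\<close> of \<open>\<Phi>(A) + \<Phi>(C)\<close>, since \<open>2 t \<le> T\<close>.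
\<close>

lemma two_sv_le:
  fixes A B C Y :: "complex mat"
  assumes A: "A \<in> carrier_mat n n" and B: "B \<in> carrier_mat n n" and C: "C \<in> carrier_mat n n"
    and psd: "psd (four_block_mat A B (mat_adjoint B) C)"
    and Y: "Y \<in> carrier_mat n n"
    and Yle: "\<And>x. x \<in> carrier_vec n \<Longrightarrow>
      vnorm (Y *\<^sub>v x) \<le> cmod (mtrace B) * vnorm x + vnorm (B *\<^sub>v x)"
    and j: "1 \<le> j" "j \<le> n"
  shows "2 * sv j Y \<le> sv j (Phi A + Phi C)"
proof -
  define t where "t = cmod (mtrace B)"
  define T where "T = Re (mtrace A) + Re (mtrace C)"
  define N where "N = Phi A + Phi C"
  define s where "s = sv j N"
  define d where "d = sv j Y - t"
  \<comment> \<open>the phase of the trace; any unit number serves when the trace vanishes\<close>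
  define w where "w = (if mtrace B = 0 then 1 else sgn (mtrace B))"
  have w: "cmod w = 1" "mtrace B = of_real t * w"
    by (simp add: w_def norm_sgn) (simp add: w_def t_def sgn_div_norm scaleR_conv_of_real)
  have ww: "w * cnj w = 1" using w(1) by (simp add: complex_norm_square[symmetric])
  have N: "N \<in> carrier_mat n n" using A C by (auto simp: N_def Phi_def)
  note bound = block_offdiagonal_bound[OF A B C psd _ _ w, folded T_def]
  have tT: "2 * t \<le> T" using bound(2)[of "0\<^sub>v n" "0\<^sub>v n"] by simp

  have Nform: "Re ((N *\<^sub>v x) \<bullet>c x) = T * (vnorm x)\<^sup>2 + (Re ((A *\<^sub>v x) \<bullet>c x) + Re ((C *\<^sub>v x) \<bullet>c x))"
    if x: "x \<in> carrier_vec n" for x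
  proof -
    have Phi: "(Phi X *\<^sub>v x) \<bullet>c x = mtrace X * (x \<bullet>c x) + (X *\<^sub>v x) \<bullet>c x"
      if X: "X \<in> carrier_mat n n" for X
    proof -
      have "Phi X *\<^sub>v x = mtrace X \<cdot>\<^sub>v x + X *\<^sub>v x"
        using X x by (simp add: Phi_def add_mult_distrib_mat_vec[of _ n n] smult_mat_mat_vec[of _ n n])
      thus ?thesis using X x by (simp add: add_scalar_prod_distrib[of _ n])
    qed
    have P: "Phi A \<in> carrier_mat n n" "Phi C \<in> carrier_mat n n" using A C by (auto simp: Phi_def)
    have "(N *\<^sub>v x) \<bullet>c x = (Phi A *\<^sub>v x) \<bullet>c x + (Phi C *\<^sub>v x) \<bullet>c x"
      unfolding N_def add_mult_distrib_mat_vec[OF P x]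
      by (rule add_scalar_prod_distrib[of _ n]) (use P x in auto)
    thus ?thesis
      unfolding Phi[OF A] Phi[OF C]
      by (simp add: T_def vnorm_sq_eq_cscalar_prod cscalar_prod_self algebra_simps)
  qed

  from singular_value_subspaces[OF N j] obtain E
    where E: "E \<in> carrier_mat n n" "mat_adjoint E * E = 1\<^sub>m n"
    and Ele: "\<And>c. c \<in> carrier_vec n \<Longrightarrow> (\<And>i. i < j - 1 \<Longrightarrow> c $ i = 0) \<Longrightarrow>
        vnorm (N *\<^sub>v (E *\<^sub>v c)) \<le> s * vnorm (E *\<^sub>v c)"
    unfolding s_def by metis
  from singular_value_subspaces[OF Y j] obtain F
    where F: "F \<in> carrier_mat n n" "mat_adjoint F * F = 1\<^sub>m n"
    and Fge: "\<And>c. c \<in> carrier_vec n \<Longrightarrow> (\<And>i. j \<le> i \<Longrightarrow> i < n \<Longrightarrow> c $ i = 0) \<Longrightarrow>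
        sv j Y * vnorm (F *\<^sub>v c) \<le> vnorm (Y *\<^sub>v (F *\<^sub>v c))"
    by metis

  have form_le: "Re ((A *\<^sub>v (E *\<^sub>v c)) \<bullet>c (E *\<^sub>v c)) + Re ((C *\<^sub>v (E *\<^sub>v c)) \<bullet>c (E *\<^sub>v c))
      \<le> (s - T) * (vnorm (E *\<^sub>v c))\<^sup>2"
    if c: "c \<in> carrier_vec n" "\<And>i. i < j - 1 \<Longrightarrow> c $ i = 0" for c
  proof -
    have Ec: "E *\<^sub>v c \<in> carrier_vec n" using E c by simp
    have "Re ((N *\<^sub>v (E *\<^sub>v c)) \<bullet>c (E *\<^sub>v c)) \<le> vnorm (N *\<^sub>v (E *\<^sub>v c)) * vnorm (E *\<^sub>v c)"
      by (rule Re_cscalar_prod_le[of _ n]) (use N Ec in auto)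
    also have "\<dots> \<le> (s * vnorm (E *\<^sub>v c)) * vnorm (E *\<^sub>v c)"
      by (rule mult_right_mono[OF Ele[OF c]]) auto
    finally show ?thesis unfolding Nform[OF Ec] by (simp add: power2_eq_square algebra_simps)
  qed

  have form_nonneg: "0 \<le> Re ((A *\<^sub>v x) \<bullet>c x)" "0 \<le> Re ((C *\<^sub>v x) \<bullet>c x)"
    if x: "x \<in> carrier_vec n" for x
  proof -
    have H: "four_block_mat A B (mat_adjoint B) C \<in> carrier_mat (n + n) (n + n)"
      using four_block_carrier_mat[OF A C] by simp
    have "B *\<^sub>v 0\<^sub>v n = 0\<^sub>v n" using B by (intro eq_vecI) auto
    thus "0 \<le> Re ((A *\<^sub>v x) \<bullet>c x)" "0 \<le> Re ((C *\<^sub>v x) \<bullet>c x)"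
      using psd_form_nonneg[OF psd H, of "x @\<^sub>v 0\<^sub>v n"]
        psd_form_nonneg[OF psd H, of "0\<^sub>v n @\<^sub>v x"] A B C x
        block_form[OF A B C x zero_carrier_vec] block_form[OF A B C zero_carrier_vec x]
      by simp_all
  qed

  \<comment> \<open>test the bound on \<open>A + C\<close> at the \<open>j\<close>-th singular vector of \<open>N\<close>\<close>
  have Ts: "T \<le> s"
  proof -
    define e where "e = (unit_vec n (j - 1) :: complex vec)"
    have e: "e \<in> carrier_vec n" "e \<noteq> 0\<^sub>v n" "\<And>i. i < j - 1 \<Longrightarrow> e $ i = 0"
      using j by (auto simp: e_def)
    have Ee: "E *\<^sub>v e \<in> carrier_vec n" using E e by simp
    have "0 \<le> (s - T) * (vnorm (E *\<^sub>v e))\<^sup>2" using form_nonneg[OF Ee] form_le[OF e(1,3)] by simp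
    moreover have "0 < vnorm (E *\<^sub>v e)"
      unfolding vnorm_unitary[OF E e(1)] by (rule vnorm_pos[OF e(1,2)])
    ultimately show ?thesis by (simp add: zero_le_mult_iff)
  qed

  show ?thesis
  proof (cases "d > 0")
    case False
    hence "2 * sv j Y \<le> 2 * t" by (simp add: d_def)
    thus ?thesis using tT Ts by (simp add: s_def N_def)
  next
    case d: True
    \<comment> \<open>\<open>G v = u + w v\<close>, and \<open>K c\<close> are its coordinates in the singular basis of \<open>N\<close> when \<open>v = F c\<close>\<close>
    define G where "G = of_real (1 / d) \<cdot>\<^sub>m B + w \<cdot>\<^sub>m 1\<^sub>m n"
    define K where "K = mat_adjoint E * (G * F)"
    have G: "G \<in> carrier_mat n n" using B by (simp add: G_def)
    have E': "mat_adjoint E \<in> carrier_mat n n" using E by simp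
    have GF: "G * F \<in> carrier_mat n n" using G F by simp
    have K: "K \<in> carrier_mat n n" using E' GF by (simp add: K_def)
    obtain c where c: "c \<in> carrier_vec n" "c \<noteq> 0\<^sub>v n"
      and Kc: "\<And>i. i < j - 1 \<Longrightarrow> (K *\<^sub>v c) $ i = 0"
      and cz: "\<And>i. j \<le> i \<Longrightarrow> i < n \<Longrightarrow> c $ i = 0"
      using exists_vector_with_prescribed_zeros[OF K j] by blast
    define v where "v = F *\<^sub>v c"
    define u where "u = of_real (1 / d) \<cdot>\<^sub>v (B *\<^sub>v v)"
    define p where "p = (1 / 2) \<cdot>\<^sub>v (u + w \<cdot>\<^sub>v v)"
    define r where "r = (1 / 2) \<cdot>\<^sub>v (u - w \<cdot>\<^sub>v v)"
    have v: "v \<in> carrier_vec n" using F c by (simp add: v_def)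
    have Bv: "B *\<^sub>v v \<in> carrier_vec n" using B v by simp
    have u: "u \<in> carrier_vec n" using Bv by (simp add: u_def)
    have p: "p \<in> carrier_vec n" and r: "r \<in> carrier_vec n" using u v by (auto simp: p_def r_def)
    have pr: "p + r = u" "cnj w \<cdot>\<^sub>v (p - r) = v"
    proof -
      show "p + r = u" using u v by (intro eq_vecI) (auto simp: p_def r_def field_simps)
      have "p - r = w \<cdot>\<^sub>v v" using u v by (intro eq_vecI) (auto simp: p_def r_def field_simps)
      thus "cnj w \<cdot>\<^sub>v (p - r) = v" using ww by (simp add: smult_smult_assoc mult.commute)
    qed

    have "0 < vnorm v" unfolding v_def vnorm_unitary[OF F c(1)] by (rule vnorm_pos[OF c])
    moreover have dv: "d * vnorm v \<le> vnorm (B *\<^sub>v v)"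
      using Fge[OF c(1) cz] Yle[OF v] unfolding v_def[symmetric] d_def t_def
      by (simp add: algebra_simps)
    ultimately have b: "0 < vnorm (B *\<^sub>v v)"
      using d by (meson less_le_trans mult_pos_pos)

    \<comment> \<open>the coordinates of \<open>p\<close> in the singular basis of \<open>N\<close>; the first \<open>j - 1\<close> of them vanish\<close>
    define c' where "c' = (1 / 2) \<cdot>\<^sub>v (K *\<^sub>v c)"
    have c': "c' \<in> carrier_vec n" "\<And>i. i < j - 1 \<Longrightarrow> c' $ i = 0"
      using K c Kc j by (auto simp: c'_def)
    have EE: "E * mat_adjoint E = 1\<^sub>m n" by (rule mat_mult_left_right_inverse[OF E' E])
    have "E *\<^sub>v c' = (1 / 2) \<cdot>\<^sub>v (E *\<^sub>v (K *\<^sub>v c))"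
      unfolding c'_def using E K c by (intro mult_mat_vec) auto
    also have "E *\<^sub>v (K *\<^sub>v c) = (E * K) *\<^sub>v c"
      using E(1) K c(1) by (rule assoc_mult_mat_vec[symmetric])
    also have "E * K = (E * mat_adjoint E) * (G * F)"
      unfolding K_def using E(1) E' GF by (rule assoc_mult_mat[symmetric])
    also have "\<dots> = G * F" unfolding EE using GF by (rule left_mult_one_mat)
    also have "(G * F) *\<^sub>v c = G *\<^sub>v v"
      unfolding v_def using G F(1) c(1) by (rule assoc_mult_mat_vec)
    also have "G *\<^sub>v v = u + w \<cdot>\<^sub>v v"
      unfolding G_def u_def using B v
      by (simp add: add_mult_distrib_mat_vec[of _ n n] smult_mat_mat_vec[of _ n n])
    finally have Ec': "E *\<^sub>v c' = p" by (simp add: p_def)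

    define al where "al = Re ((A *\<^sub>v p) \<bullet>c p) + Re ((C *\<^sub>v p) \<bullet>c p)"
    have al: "al \<le> (s - T) * (vnorm p)\<^sup>2"
      using form_le[OF c'] by (simp add: Ec' al_def)
    have "4 * d * ((vnorm (B *\<^sub>v v))\<^sup>2 / d\<^sup>2) = 4 * ((vnorm (B *\<^sub>v v))\<^sup>2 / d)"
      using d by (simp add: power2_eq_square)
    also have "4 * ((vnorm (B *\<^sub>v v))\<^sup>2 / d) = 4 * Re ((B *\<^sub>v v) \<bullet>c u)"
      unfolding u_def using Bv
      by (simp add: conjugate_smult_vec vnorm_sq_eq_cscalar_prod)
    also have "\<dots> \<le> (sqrt (2 * al) + sqrt (T - 2 * t) * vnorm r)\<^sup>2"
      using bound(1)[OF p r] unfolding pr al_def .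
    also have "\<dots> \<le> (2 * (s - T) + (T - 2 * t)) * ((vnorm p)\<^sup>2 + (vnorm r)\<^sup>2)"
    proof -
      let ?a = "sqrt (2 * (s - T))" and ?b = "sqrt (T - 2 * t)"
      have "sqrt (2 * al) \<le> sqrt (2 * (s - T) * (vnorm p)\<^sup>2)"
        unfolding mult.assoc real_sqrt_le_iff using al by simp
      also have "\<dots> = ?a * vnorm p" by (simp only: real_sqrt_mult real_sqrt_abs) simp
      finally have "sqrt (2 * al) \<le> ?a * vnorm p" .
      moreover have "0 \<le> sqrt (2 * al)" "0 \<le> ?b * vnorm r"
        using form_nonneg[OF p] tT by (auto simp: al_def)
      ultimately have "(sqrt (2 * al) + ?b * vnorm r)\<^sup>2 \<le> (?a * vnorm p + ?b * vnorm r)\<^sup>2"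
        by (intro power_mono) auto
      also have "\<dots> \<le> (?a\<^sup>2 + ?b\<^sup>2) * ((vnorm p)\<^sup>2 + (vnorm r)\<^sup>2)"
        by (rule cauchy_schwarz_two)
      also have "?a\<^sup>2 + ?b\<^sup>2 = 2 * (s - T) + (T - 2 * t)" using Ts tT by simp
      finally show ?thesis .
    qed
    also have "(vnorm p)\<^sup>2 + (vnorm r)\<^sup>2 = ((vnorm u)\<^sup>2 + (vnorm v)\<^sup>2) / 2"
      using vnorm_parallelogram[OF p r, of "cnj w"] w(1) unfolding pr by simp
    also have "(2 * (s - T) + (T - 2 * t)) * (((vnorm u)\<^sup>2 + (vnorm v)\<^sup>2) / 2)
        \<le> (2 * (s - T) + (T - 2 * t)) * ((vnorm (B *\<^sub>v v))\<^sup>2 / d\<^sup>2)"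
    proof (rule mult_left_mono)
      have average_le: "(x + y) / 2 \<le> z" if "x = z" "y \<le> z" for x y z :: real using that by simp
      have "vnorm u = vnorm (B *\<^sub>v v) / d" using d by (simp add: u_def vnorm_smult norm_divide)
      moreover have "(vnorm v)\<^sup>2 \<le> (vnorm (B *\<^sub>v v) / d)\<^sup>2"
        using dv d by (intro power_mono) (auto simp: field_simps)
      ultimately have "(vnorm u)\<^sup>2 = (vnorm (B *\<^sub>v v))\<^sup>2 / d\<^sup>2"
        "(vnorm v)\<^sup>2 \<le> (vnorm (B *\<^sub>v v))\<^sup>2 / d\<^sup>2"
        by (simp_all add: power_divide)
      thus "((vnorm u)\<^sup>2 + (vnorm v)\<^sup>2) / 2 \<le> (vnorm (B *\<^sub>v v))\<^sup>2 / d\<^sup>2" by (rule average_le)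
    qed (use Ts tT in simp)
    finally have "4 * d \<le> 2 * (s - T) + (T - 2 * t)"
      by (rule mult_right_le_imp_le) (use b d in simp)
    hence "2 * (d + t) \<le> s" using tT by argo
    thus ?thesis by (simp add: d_def s_def N_def)
  qed
qed

theorem theorem6p6:
  fixes n :: nat and A B C :: "complex mat"
  assumes "n \<ge> 1"
    and "A \<in> carrier_mat n n" and "B \<in> carrier_mat n n" and "C \<in> carrier_mat n n"
    and "psd (four_block_mat A B (mat_adjoint B) C)"
  shows "\<forall>j \<in> {1..n}.
           2 * sv j (Phi B) \<le> sv j (Phi A + Phi C) \<and>
           2 * sv j (Psi B) \<le> sv j (Phi A + Phi C)"
proof (intro ballI conjI)
  fix j assume "j \<in> {1..n}"
  hence j: "1 \<le> j" "j \<le> n" by auto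
  note B = assms(3)
  have bound: "vnorm (Y *\<^sub>v x) \<le> cmod (mtrace B) * vnorm x + vnorm (B *\<^sub>v x)"
    if x: "x \<in> carrier_vec n" and Y: "Y *\<^sub>v x = mtrace B \<cdot>\<^sub>v x + k \<cdot>\<^sub>v (B *\<^sub>v x)" and k: "cmod k = 1"
    for x Y k
    using vnorm_triangle[of "mtrace B \<cdot>\<^sub>v x" n "k \<cdot>\<^sub>v (B *\<^sub>v x)"] x B k
    by (simp add: Y vnorm_smult)
  have Phi: "Phi B *\<^sub>v x = mtrace B \<cdot>\<^sub>v x + 1 \<cdot>\<^sub>v (B *\<^sub>v x)" if "x \<in> carrier_vec n" for x
    using that B by (simp add: Phi_def add_mult_distrib_mat_vec[of _ n n] smult_mat_mat_vec[of _ n n])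
  have Psi: "Psi B *\<^sub>v x = mtrace B \<cdot>\<^sub>v x + (- 1) \<cdot>\<^sub>v (B *\<^sub>v x)" if "x \<in> carrier_vec n" for x
    using that B by (simp add: Psi_def minus_mult_distrib_mat_vec[of _ n n] smult_mat_mat_vec[of _ n n]) auto
  show "2 * sv j (Phi B) \<le> sv j (Phi A + Phi C)"
    using B by (intro two_sv_le[OF assms(2-5) _ _ j] bound[OF _ Phi]) (auto simp: Phi_def)
  show "2 * sv j (Psi B) \<le> sv j (Phi A + Phi C)"
    using B by (intro two_sv_le[OF assms(2-5) _ _ j] bound[OF _ Psi]) (auto simp: Psi_def)
qed

end
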